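(* Let $p$ be any prime (odd or even) and $n\ge k\ge 1$ integers. Assume that $\nu_p(k)\le\nu_p(n)$ and $p-1\mid n-k$. Then $S(n,k)$ is an almost minimum zero case (AMZC) if and only if $S(n+1,k+1)$ is a shifted almost minimum zero case (SAMZC), and if $S(n,k)$ is an AMZC, then $\nu_p(S(n+1,k+1))=\nu_p(S(n,k))$. Similarly, if $\nu_p(k-1)\le\nu_p(n-1)$ and $p-1\mid n-k$, then $S(n-1,k-1)$ is an AMZC if and only if $S(n,k)$ is a SAMZC, and if $S(n-1,k-1)$ is an AMZC, then $\nu_p(S(n,k))=\nu_p(S(n-1,k-1))$.
   Context: $S(n,k)$ is the Stirling number of the second kind; $\nu_p$ is the $p$-adic valuation, with $\nu_p(0)=\infty$. Higher order Bernoulli polynomials $B_m^{(l)}(x)$ ($m\ge 0$, $l\in\mathbb Z$) are defined by $\left(\frac{t}{e^t-1}\right)^l e^{tx}=\sum_{m\ge 0}B_m^{(l)}(x)\frac{t^m}{m!}$; $B_m^{(l)}(x)$ is monic of degree $m$ with rational coefficients, and $B_m^{(l)}=B_m^{(l)}(0)$. The maximum pole (with respect to $p$) of a nonzero rational polynomial is the integer $M$ such that $-M$ is the minimum of the $p$-adic valuations of its coefficients. $S(n,k)$ is an almost minimum zero case (AMZC) if $\nu_p(S(n,k))=\nu_p\left(\binom nk\right)-M$, where $M$ is the maximum pole of $B_{n-k}^{(-k)}(x)$. $S(n,k)$ ($k\ge 1$) is a shifted almost minimum zero case (SAMZC) if $\nu_p(S(n,k))=\nu_p\left(\binom{n-1}{k-1}\right)-M'$,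 where $M'$ is the maximum pole of $B_{n-k}^{(-k+1)}(x)$. *)

theory Defs
  imports
    "HOL-Computational_Algebra.Computational_Algebra"
    "HOL-Combinatorics.Stirling"
    "HOL-Library.Extended_Real"
begin

text \<open>The exponent of \<open>p\<close> in a nonzero rational number; at \<open>0\<close> this function returns \<open>0\<close>,
  and the value \<open>\<infinity>\<close> is supplied by \<open>nu\<close> below.\<close>

definition rat_val :: "nat \<Rightarrow> rat \<Rightarrow> int" where
  "rat_val p x = int (multiplicity (int p) (fst (quotient_of x)))
               - int (multiplicity (int p) (snd (quotient_of x)))"

definition nu :: "nat \<Rightarrow> rat \<Rightarrow> ereal" where
  "nu p x = (if x = 0 then \<infinity> else ereal (real_of_int (rat_val p x)))"

text \<open>The series \<open>(t / (e^t - 1))^l\<close> over the rationals. Its denominator has zero constant term;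
  division of formal power series over a field cancels the common factor \<open>t\<close>, and the
  quotient has constant term \<open>1\<close>, so that negative powers are genuine inverses.\<close>

definition bernoulli_gen :: "int \<Rightarrow> rat fps" where
  "bernoulli_gen l = (fps_X / (fps_exp 1 - 1)) powi l"

text \<open>The generating function identity is read in power series in \<open>t\<close> whose coefficients are
  polynomials in \<open>x\<close>; the second factor is \<open>e^(t x)\<close>, with coefficients \<open>x^m / m!\<close>.\<close>

definition bernoulli_poly_gen :: "int \<Rightarrow> rat poly fps" where
  "bernoulli_poly_gen l =
     Abs_fps (\<lambda>m. [:fps_nth (bernoulli_gen l) m:]) * Abs_fps (\<lambda>m. monom (1 / fact m) m)"

definition ho_bernpoly :: "nat \<Rightarrow> int \<Rightarrow> rat poly" where
  "ho_bernpoly m l = smult (fact m) (fps_nth (bernoulli_poly_gen l) m)"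

text \<open>Meaningful for nonzero polynomials only. Zero coefficients have valuation \<open>\<infinity>\<close>,
  so the minimum is taken over the nonzero ones.\<close>

definition max_pole :: "nat \<Rightarrow> rat poly \<Rightarrow> int" where
  "max_pole p f = - Min (rat_val p ` (set (coeffs f) - {0}))"

definition AMZC :: "nat \<Rightarrow> nat \<Rightarrow> nat \<Rightarrow> bool" where
  "AMZC p n k \<longleftrightarrow> k \<le> n \<and>
     nu p (of_nat (Stirling n k)) =
       nu p (of_nat (n choose k))
       - ereal (real_of_int (max_pole p (ho_bernpoly (n - k) (- int k))))"

definition SAMZC :: "nat \<Rightarrow> nat \<Rightarrow> nat \<Rightarrow> bool" where
  "SAMZC p n k \<longleftrightarrow> 1 \<le> k \<and> k \<le> n \<and>
     nu p (of_nat (Stirling n k)) =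
       nu p (of_nat ((n - 1) choose (k - 1)))
       - ereal (real_of_int (max_pole p (ho_bernpoly (n - k) (- int k + 1))))"

end

theory Submission
  imports "HOL-Number_Theory.Residue_Primitive_Roots" Defs
begin

text \<open>
  Write \<open>E = e\<^sup>t - 1\<close> and \<open>L\<close> for the coefficient of \<open>t\<^sup>n\<close>. Up to the common factor \<open>n choose k\<close>,
  \<open>S(n, k)\<close> is the value at \<open>0\<close> of \<open>B(x) = B\<^bsub>n-k\<^esub>\<^bsup>(-k)\<^esup>(x)\<close>, while \<open>S(n + 1, k + 1)\<close> is the value
  at \<open>1\<close> of the same polynomial, and both differ by a multiple of \<open>L(E\<^bsup>k+1\<^esup>)\<close>. So it suffices that
  \<open>B(1) - B(0)\<close> has smaller pole than \<open>B\<close>.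

  After scaling by a constant \<open>g\<close>, the polynomial \<open>B\<close> is \<open>p\<close>-integral iff \<open>L(g E\<^sup>k d)\<close> is \<open>p\<close>-integral for
  every Hurwitz series \<open>d = \<Sum> b\<^sub>j t\<^sup>j / j!\<close> with \<open>p\<close>-integral \<open>b\<^sub>j\<close>; we say that \<open>g E\<^sup>k\<close> pairs integrally.
  If \<open>g E\<^sup>c\<close> pairs integrally and \<open>p\<close> does not divide \<open>c\<close>, applying \<open>t \<cdot> d/dt\<close> shows that \<open>g t E\<^bsup>c-1\<^esup>\<close>
  does too, and \<open>(1 + E)\<^sup>p = e\<^bsup>p t\<^esup>\<close> then gives the same for \<open>g E\<^bsup>c-1+p\<^esup> / p\<close>. For \<open>p\<close> not dividing \<open>k\<close>
  this makes \<open>L(g E\<^bsup>k+j\<^esup>)\<close> divisible by \<open>p\<close> for all \<open>j \<ge> p - 1\<close>. For \<open>p\<close> dividing \<open>k\<close> it does so only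
  for \<open>j \<ge> p\<close>, with growing powers of \<open>p\<close>; expanding \<open>t = log (1 + E)\<close> in
  \<open>n L(E\<^sup>k) = k L(t E\<^bsup>k-1\<^esup> e\<^sup>t)\<close>, where \<open>n / k\<close> is \<open>p\<close>-integral, supplies \<open>j = p - 1\<close>.
  Finally, comparing \<open>t\<close> with \<open>a t\<close> for a primitive root \<open>a\<close> and using that \<open>p - 1\<close> divides \<open>n - k\<close>
  descends from \<open>j \<ge> p - 1\<close> to \<open>j = 1\<close>.
\<close>

subsection \<open>\<open>p\<close>-integral rationals and the pairing with Hurwitz series\<close>

text \<open>The localization of Z at p. Integrality is a ring membership, so sums and the value 0
  need no case distinctions; \<open>plocal_iff_rat_val\<close> links it to valuations.\<close>

definition plocal :: "nat \<Rightarrow> rat set" where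
  "plocal p = {x. \<exists>a b :: int. \<not> int p dvd b \<and> x = of_int a / of_int b}"

definition hurwitz :: "nat \<Rightarrow> rat fps set" where
  "hurwitz p = {d. \<forall>i. fact i * fps_nth d i \<in> plocal p}"

definition pairs_integrally :: "nat \<Rightarrow> nat \<Rightarrow> rat fps \<Rightarrow> bool" where
  "pairs_integrally p n h \<longleftrightarrow> (\<forall>d \<in> hurwitz p. fps_nth (h * d) n \<in> plocal p)"

abbreviation expm1 :: "rat fps" where
  "expm1 \<equiv> fps_exp 1 - 1"

lemma X_deriv_nth: "fps_nth (fps_X * fps_deriv d) i = of_nat i * fps_nth d i"
  for d :: "rat fps"
  by (cases i) simp_all

text \<open>The operator t d/dt multiplies the coefficient of t^n by n; the product rule and E' =
  e^t give the two summands.\<close>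

lemma euler_expm1_power:
  assumes "c > 0"
  shows "of_nat n * fps_nth (expm1 ^ c * d) n =
    of_nat c * fps_nth (fps_X * expm1 ^ (c - 1) * fps_exp 1 * d) n +
    fps_nth (expm1 ^ c * (fps_X * fps_deriv d)) n"
proof -
  have "of_nat n * fps_nth (expm1 ^ c * d) n = fps_nth (fps_X * fps_deriv (expm1 ^ c * d)) n"
    by (simp only: X_deriv_nth)
  also have "fps_X * fps_deriv (expm1 ^ c * d) =
    fps_const (of_nat c) * (fps_X * expm1 ^ (c - 1) * fps_exp 1 * d) +
    expm1 ^ c * (fps_X * fps_deriv d)"
    by (simp add: fps_deriv_power' fps_of_nat algebra_simps)
  finally show ?thesis by simp
qed

locale fixed_prime =
  fixes p :: nat
  assumes prime_p: "prime p"
begin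

section \<open>Arithmetic of p-integral rationals\<close>

lemma plocalI: "\<not> int p dvd b \<Longrightarrow> of_int a / of_int b \<in> plocal p"
  unfolding plocal_def by blast

lemma plocalE:
  assumes "x \<in> plocal p"
  obtains a b where "\<not> int p dvd b" "x = of_int a / of_int b" "b \<noteq> 0"
  using assms unfolding plocal_def by force

lemma not_dvd_1: "\<not> int p dvd 1"
  using prime_p by (metis int_dvd_int_iff not_prime_unit of_nat_1)

lemma plocal_of_int [simp, intro]: "of_int a \<in> plocal p"
  using plocalI[of 1 a] not_dvd_1 by simp

lemma plocal_of_nat [simp, intro]: "of_nat a \<in> plocal p"
  using plocal_of_int[of "int a"] by simp

lemma plocal_0 [simp, intro]: "0 \<in> plocal p"
  using plocal_of_int[of 0] by simp

lemma plocal_1 [simp, intro]: "1 \<in> plocal p"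
  using plocal_of_int[of 1] by simp

lemma plocal_mult [intro]:
  assumes "x \<in> plocal p" "y \<in> plocal p"
  shows "x * y \<in> plocal p"
proof -
  obtain a b where ab: "\<not> int p dvd b" "x = of_int a / of_int b" by (rule plocalE[OF assms(1)])
  obtain c d where cd: "\<not> int p dvd d" "y = of_int c / of_int d" by (rule plocalE[OF assms(2)])
  have "\<not> int p dvd b * d"
    using ab(1) cd(1) prime_p by (simp add: prime_dvd_mult_iff)
  from plocalI[OF this, of "a * c"] show ?thesis by (simp add: ab cd)
qed

lemma plocal_add [intro]:
  assumes "x \<in> plocal p" "y \<in> plocal p"
  shows "x + y \<in> plocal p"
proof -
  obtain a b where ab: "\<not> int p dvd b" "x = of_int a / of_int b" "b \<noteq> 0"
    by (rule plocalE[OF assms(1)])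
  obtain c d where cd: "\<not> int p dvd d" "y = of_int c / of_int d" "d \<noteq> 0"
    by (rule plocalE[OF assms(2)])
  have "\<not> int p dvd b * d"
    using ab(1) cd(1) prime_p by (simp add: prime_dvd_mult_iff)
  from plocalI[OF this, of "a * d + c * b"] show ?thesis
    using ab(3) cd(3) by (simp add: ab(2) cd(2) add_frac_eq mult.commute)
qed

lemma plocal_uminus_iff [simp]: "- x \<in> plocal p \<longleftrightarrow> x \<in> plocal p"
  using plocal_mult[of "of_int (-1)" x] plocal_mult[of "of_int (-1)" "- x"] plocal_of_int[of "-1"]
  by auto

lemma plocal_diff [intro]: "x \<in> plocal p \<Longrightarrow> y \<in> plocal p \<Longrightarrow> x - y \<in> plocal p"
  using plocal_add[of x "- y"] by simp

lemma plocal_sum [intro]: "(\<And>i. i \<in> A \<Longrightarrow> f i \<in> plocal p) \<Longrightarrow> sum f A \<in> plocal p"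
  by (induction A rule: infinite_finite_induct) auto

lemma plocal_power [intro]: "x \<in> plocal p \<Longrightarrow> x ^ i \<in> plocal p"
  by (induction i) auto

lemma plocal_divide_int:
  assumes "x \<in> plocal p" "\<not> int p dvd b"
  shows "x / of_int b \<in> plocal p"
  using plocal_mult[OF assms(1) plocalI[OF assms(2), of 1]] by simp

lemma plocal_divide_nat:
  assumes "x \<in> plocal p" "\<not> p dvd b"
  shows "x / of_nat b \<in> plocal p"
  using plocal_divide_int[OF assms(1), of "int b"] assms(2) by simp

lemma plocal_cancel_nat:
  assumes "of_nat b * x \<in> plocal p" "\<not> p dvd b"
  shows "x \<in> plocal p"
proof -
  have "b \<noteq> 0" using assms(2) by (metis dvd_0_right)
  with plocal_divide_nat[OF assms] show ?thesis by simp
qed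

lemma dvd_of_nat_divide_plocal:
  assumes "of_nat n / of_nat p \<in> plocal p"
  shows "p dvd n"
proof -
  obtain a b where ab: "\<not> int p dvd b" "of_nat n / of_nat p = (of_int a / of_int b :: rat)" "b \<noteq> 0"
    by (rule plocalE[OF assms])
  have "(of_int (int n * b) :: rat) = of_int (a * int p)"
    using ab(2,3) prime_gt_0_nat[OF prime_p] by (simp add: frac_eq_eq)
  hence "int n * b = a * int p" by (simp only: of_int_eq_iff)
  hence "int p dvd int n * b" by simp
  thus ?thesis using ab(1) prime_p by (simp add: prime_dvd_mult_iff)
qed

lemma dvd_of_plocal_quotient:
  assumes "of_nat n / of_nat k \<in> plocal p" "p dvd k" "0 < k"
  shows "p dvd n"
proof -
  obtain l where l: "k = p * l" using assms(2) by (elim dvdE)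
  have "of_nat l * (of_nat n / of_nat k :: rat) \<in> plocal p" using assms(1) by blast
  moreover have "of_nat l * (of_nat n / of_nat k :: rat) = of_nat n / of_nat p"
    using assms(3) l by simp
  ultimately show ?thesis using dvd_of_nat_divide_plocal by simp
qed

lemma plocal_power_div_nat:
  assumes "multiplicity p j \<le> e" "j > 0"
  shows "of_nat p ^ e / of_nat j \<in> plocal p"
proof -
  define f where "f = multiplicity p j"
  obtain r where r: "j = p ^ f * r" "\<not> p dvd r"
    using multiplicity_decompose'[of j p] assms(2) prime_p unfolding f_def
    by (metis gr_implies_not0 not_prime_unit)
  have p0: "(of_nat p :: rat) \<noteq> 0" using prime_gt_0_nat[OF prime_p] by simp
  have "of_nat p ^ e / (of_nat j :: rat) = of_nat (p ^ (e - f)) / of_nat r"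
  proof -
    have "e = f + (e - f)" using assms(1) unfolding f_def by simp
    hence "(of_nat p :: rat) ^ e = of_nat p ^ f * of_nat p ^ (e - f)" by (metis power_add)
    thus ?thesis using p0 by (simp add: r(1))
  qed
  thus ?thesis using plocal_divide_nat[OF plocal_of_nat[of "p ^ (e - f)"] r(2)] by simp
qed

lemma multiplicity_less: "j > 0 \<Longrightarrow> multiplicity p j < j"
  using power_gt_expt[OF prime_gt_1_nat[OF prime_p, folded One_nat_def[symmetric], unfolded One_nat_def], of "multiplicity p j"]
    dvd_imp_le[OF multiplicity_dvd, of j p] by linarith

section \<open>Closure properties of Hurwitz series\<close>

lemma hurwitzI: "(\<And>i. fact i * fps_nth d i \<in> plocal p) \<Longrightarrow> d \<in> hurwitz p"
  unfolding hurwitz_def by blast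

lemma hurwitzD: "d \<in> hurwitz p \<Longrightarrow> fact i * fps_nth d i \<in> plocal p"
  unfolding hurwitz_def by blast

lemma hurwitz_diff [intro]: "d \<in> hurwitz p \<Longrightarrow> e \<in> hurwitz p \<Longrightarrow> d - e \<in> hurwitz p"
  by (intro hurwitzI) (auto simp: right_diff_distrib hurwitzD)

lemma hurwitz_mult [intro]:
  assumes "d \<in> hurwitz p" "e \<in> hurwitz p"
  shows "d * e \<in> hurwitz p"
proof (rule hurwitzI)
  fix i
  have "fact i * fps_nth (d * e) i =
    (\<Sum>j=0..i. of_nat (i choose j) * ((fact j * fps_nth d j) * (fact (i - j) * fps_nth e (i - j))))"
    unfolding fps_mult_nth sum_distrib_left
    by (intro sum.cong refl) (simp add: binomial_fact)
  thus "fact i * fps_nth (d * e) i \<in> plocal p"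
    using assms by (auto intro!: plocal_sum plocal_mult hurwitzD)
qed

lemma hurwitz_const [intro]: "x \<in> plocal p \<Longrightarrow> fps_const x \<in> hurwitz p"
  by (intro hurwitzI) auto

lemma hurwitz_1 [intro, simp]: "1 \<in> hurwitz p"
  using hurwitz_const[of 1] by simp

lemma hurwitz_power [intro]: "d \<in> hurwitz p \<Longrightarrow> d ^ i \<in> hurwitz p"
  by (induction i) auto

lemma hurwitz_exp [intro]: "x \<in> plocal p \<Longrightarrow> fps_exp x \<in> hurwitz p"
  by (intro hurwitzI) auto

lemma hurwitz_expm1 [intro, simp]: "expm1 \<in> hurwitz p"
  by auto

lemma hurwitz_X_deriv [intro]:
  assumes "d \<in> hurwitz p"
  shows "fps_X * fps_deriv d \<in> hurwitz p"
proof (rule hurwitzI)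
  fix i
  have "fact i * fps_nth (fps_X * fps_deriv d) i = of_nat i * (fact i * fps_nth d i)"
    unfolding X_deriv_nth by simp
  also have "\<dots> \<in> plocal p"
    by (intro plocal_mult plocal_of_nat hurwitzD assms)
  finally show "fact i * fps_nth (fps_X * fps_deriv d) i \<in> plocal p" .
qed

section \<open>The pairing, and gaining a factor p\<close>

lemma pairs_integrallyD:
  "pairs_integrally p n h \<Longrightarrow> d \<in> hurwitz p \<Longrightarrow> fps_nth (h * d) n \<in> plocal p"
  unfolding pairs_integrally_def by blast

lemma pairs_integrally_nth: "pairs_integrally p n h \<Longrightarrow> fps_nth h n \<in> plocal p"
  using pairs_integrallyD[of n h 1] by simp

lemma pairs_integrally_mult:
  "pairs_integrally p n h \<Longrightarrow> d \<in> hurwitz p \<Longrightarrow> pairs_integrally p n (h * d)"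
  unfolding pairs_integrally_def by (auto simp: mult.assoc)

lemma pairs_integrally_diff:
  "pairs_integrally p n h \<Longrightarrow> pairs_integrally p n h' \<Longrightarrow> pairs_integrally p n (h - h')"
  unfolding pairs_integrally_def by (auto simp: left_diff_distrib)

lemma pairs_integrally_sum:
  "(\<And>i. i \<in> A \<Longrightarrow> pairs_integrally p n (f i)) \<Longrightarrow> pairs_integrally p n (sum f A)"
  unfolding pairs_integrally_def by (auto simp: sum_distrib_right fps_sum_nth)

text \<open>It suffices to pair with the series t^j / j!, since every Hurwitz series combines them
  with p-integral coefficients. For h = g E^k these pairings are, up to scaling, the coefficients of
  B.\<close>

lemma pairs_integrally_coeffs:
  assumes "\<And>j. j \<le> n \<Longrightarrow> fps_nth h (n - j) / fact j \<in> plocal p"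
  shows "pairs_integrally p n h"
  unfolding pairs_integrally_def
proof
  fix d assume d: "d \<in> hurwitz p"
  have "fps_nth (d * h) n = (\<Sum>j=0..n. (fact j * fps_nth d j) * (fps_nth h (n - j) / fact j))"
    unfolding fps_mult_nth by (intro sum.cong refl) simp
  also have "\<dots> \<in> plocal p"
    using assms d by (intro plocal_sum plocal_mult hurwitzD) auto
  finally show "fps_nth (h * d) n \<in> plocal p" by (simp only: mult.commute)
qed

text \<open>In \<open>euler_expm1_power\<close> all terms but the one with factor c pair integrally,
  and c is a unit at p.\<close>

lemma pairs_integrally_X_expm1_power:
  assumes "c > 0" "\<not> p dvd c" "pairs_integrally p n (fps_const g * expm1 ^ c)"
  shows "pairs_integrally p n (fps_const g * (fps_X * expm1 ^ (c - 1)))"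
  unfolding pairs_integrally_def
proof
  fix d assume d: "d \<in> hurwitz p"
  \<comment> \<open>This twist cancels the factor \<open>fps_exp 1\<close> that differentiating E
    produces.\<close>
  define e where "e = fps_exp (- 1) * d"
  have e: "e \<in> hurwitz p" unfolding e_def using d by (auto intro!: hurwitz_mult hurwitz_exp)
  have "fps_exp 1 * e = (fps_exp 1 * fps_exp (- 1)) * d" unfolding e_def by (simp only: mult.assoc)
  hence de: "fps_exp 1 * e = d" by (simp flip: fps_exp_add_mult)
  have "of_nat c * (g * fps_nth (fps_X * expm1 ^ (c - 1) * fps_exp 1 * e) n) =
    of_nat n * fps_nth (fps_const g * expm1 ^ c * e) n -
    fps_nth (fps_const g * expm1 ^ c * (fps_X * fps_deriv e)) n"
    using arg_cong[where f = "\<lambda>x. g * x", OF euler_expm1_power[OF assms(1), of n e]]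
    unfolding mult.assoc[of "fps_const g"] fps_mult_left_const_nth
    by (simp only: algebra_simps)
  also have "\<dots> \<in> plocal p"
    using assms(3) e by (intro plocal_diff plocal_mult plocal_of_nat pairs_integrallyD) auto
  finally have "g * fps_nth (fps_X * expm1 ^ (c - 1) * fps_exp 1 * e) n \<in> plocal p"
    by (rule plocal_cancel_nat[OF _ assms(2)])
  thus "fps_nth (fps_const g * (fps_X * expm1 ^ (c - 1)) * d) n \<in> plocal p"
    unfolding mult.assoc de by simp
qed

text \<open>The series (e^(pt) - 1) / (pt), given by coefficients to make its Hurwitz integrality
  visible.\<close>

definition expm1_quot :: "rat fps" where
  "expm1_quot = Abs_fps (\<lambda>i. of_nat p ^ i / fact (i + 1))"

lemma expm1_quot_eq: "fps_const (of_nat p) * fps_X * expm1_quot = fps_exp (of_nat p) - 1"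
proof (rule fps_ext)
  fix i
  show "fps_nth (fps_const (of_nat p) * fps_X * expm1_quot) i = fps_nth (fps_exp (of_nat p) - 1) i"
    by (cases i) (simp_all add: expm1_quot_def mult.assoc algebra_simps)
qed

lemma expm1_quot_hurwitz: "expm1_quot \<in> hurwitz p"
proof (rule hurwitzI)
  fix i
  have "fact i * fps_nth expm1_quot i = of_nat p ^ i / of_nat (i + 1)"
    by (simp add: expm1_quot_def)
  also have "\<dots> \<in> plocal p"
    using multiplicity_less[of "i + 1"] by (intro plocal_power_div_nat) auto
  finally show "fact i * fps_nth expm1_quot i \<in> plocal p" .
qed

text \<open>Expand (1 + E)^p = e^(pt) and solve for E^p; p divides every middle binomial coefficient
  as well as e^(pt) - 1 = p t \<open>expm1_quot\<close>.\<close>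

lemma expm1_power_p:
  "expm1 ^ p = fps_const (of_nat p) * (fps_X * expm1_quot -
     (\<Sum>i\<in>{1..<p}. fps_const (of_nat ((p choose i) div p)) * expm1 ^ i))"
proof -
  have p: "p > 0" using prime_gt_0_nat[OF prime_p] .
  have "fps_exp (of_nat p) = (expm1 + 1) ^ p"
    by (simp add: fps_exp_power_mult)
  also have "\<dots> = (\<Sum>i\<le>p. of_nat (p choose i) * expm1 ^ i)"
    unfolding binomial_ring by simp
  also have "{..p} = insert 0 (insert p {1..<p})" using p by auto
  also have "(\<Sum>i\<in>insert 0 (insert p {1..<p}). of_nat (p choose i) * expm1 ^ i) =
      1 + expm1 ^ p + (\<Sum>i\<in>{1..<p}. of_nat (p choose i) * expm1 ^ i)"
    using p by (simp add: algebra_simps)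
  also have "(\<Sum>i\<in>{1..<p}. of_nat (p choose i) * expm1 ^ i) =
     fps_const (of_nat p) * (\<Sum>i\<in>{1..<p}. fps_const (of_nat ((p choose i) div p)) * expm1 ^ i)"
    unfolding sum_distrib_left
  proof (intro sum.cong refl)
    fix i assume "i \<in> {1..<p}"
    hence "p dvd (p choose i)" using prime_p by (intro dvd_choose_prime) auto
    hence "p choose i = p * ((p choose i) div p)" by simp
    hence "(of_nat (p choose i) :: rat fps) = fps_const (of_nat p) * fps_const (of_nat ((p choose i) div p))"
      by (metis fps_of_nat of_nat_mult)
    thus "of_nat (p choose i) * expm1 ^ i =
       fps_const (of_nat p) * (fps_const (of_nat ((p choose i) div p)) * expm1 ^ i)"
      by (simp add: mult.assoc)
  qed
  finally show ?thesis
    using expm1_quot_eq by (simp add: algebra_simps)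
qed

text \<open>Replace E^p by \<open>expm1_power_p\<close>, which cancels the p. The term with t is
  \<open>pairs_integrally_X_expm1_power\<close>; in the others i >= 1 gives c - 1 + i >= c, so they
  are Hurwitz multiples of E^c.\<close>

lemma pairs_integrally_gain:
  assumes "c > 0" "\<not> p dvd c" "pairs_integrally p n (fps_const g * expm1 ^ c)"
  shows "pairs_integrally p n (fps_const (g / of_nat p) * expm1 ^ (c - 1 + p))"
proof -
  have p: "p > 0" using prime_gt_0_nat[OF prime_p] .
  have g: "fps_const (g / of_nat p) * fps_const (of_nat p) = fps_const g" using p by simp
  have "fps_const (g / of_nat p) * expm1 ^ (c - 1 + p) =
     (fps_const (g / of_nat p) * fps_const (of_nat p)) * expm1 ^ (c - 1) * (fps_X * expm1_quot -
     (\<Sum>i\<in>{1..<p}. fps_const (of_nat ((p choose i) div p)) * expm1 ^ i))"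
    unfolding power_add expm1_power_p by (simp only: mult_ac)
  also have "\<dots> = fps_const g * (fps_X * expm1 ^ (c - 1)) * expm1_quot -
     (\<Sum>i\<in>{1..<p}. fps_const g * expm1 ^ c * (fps_const (of_nat ((p choose i) div p)) * expm1 ^ (i - 1)))"
  proof -
    have "fps_const g * expm1 ^ (c - 1) * (x * expm1 ^ i) =
        fps_const g * expm1 ^ c * (x * expm1 ^ (i - 1))" if "i \<in> {1..<p}" for i x
    proof -
      have "expm1 ^ (c - 1) * expm1 ^ i = expm1 ^ c * expm1 ^ (i - 1)"
        using that assms(1) by (simp flip: power_add)
      hence "fps_const g * x * (expm1 ^ (c - 1) * expm1 ^ i) =
          fps_const g * x * (expm1 ^ c * expm1 ^ (i - 1))"
        by (simp only:)
      thus ?thesis by (simp only: mult_ac)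
    qed
    hence "(\<Sum>i\<in>{1..<p}. fps_const g * expm1 ^ (c - 1) * (f i * expm1 ^ i)) =
        (\<Sum>i\<in>{1..<p}. fps_const g * expm1 ^ c * (f i * expm1 ^ (i - 1)))" for f
      by (intro sum.cong refl) auto
    thus ?thesis unfolding g right_diff_distrib sum_distrib_left
      by (simp only: mult.assoc mult.left_commute[of _ fps_X])
  qed
  finally show ?thesis
    using assms pairs_integrally_X_expm1_power[OF assms]
    by (auto intro!: pairs_integrally_diff pairs_integrally_sum pairs_integrally_mult
        expm1_quot_hurwitz hurwitz_mult hurwitz_const hurwitz_power)
qed

text \<open>An exponent divisible by p permits no gain directly. One extra factor E makes it prime
  to p, and the loss of 1 in \<open>pairs_integrally_gain\<close> undoes this, so each round adds
  exactly p to the exponent.\<close>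

lemma pairs_integrally_gain_iter:
  assumes "p dvd k" "pairs_integrally p n (fps_const g * expm1 ^ k)"
  shows "pairs_integrally p n (fps_const (g / of_nat p ^ b) * expm1 ^ (k + b * p))"
proof (induction b)
  case 0
  thus ?case using assms by simp
next
  case (Suc b)
  have "\<not> p dvd k + b * p + 1"
    using assms(1) prime_p by (metis dvd_add_right_iff dvd_triv_right dvd_add not_prime_unit)
  moreover have "pairs_integrally p n (fps_const (g / of_nat p ^ b) * expm1 ^ (k + b * p + 1))"
    using pairs_integrally_mult[OF Suc.IH, of expm1] by (simp add: mult_ac)
  ultimately show ?case
    using pairs_integrally_gain[of "k + b * p + 1" n "g / of_nat p ^ b"] by (simp add: add_ac mult.commute)
qed

end

subsection \<open>Series in \<open>e\<^sup>t - 1\<close>: rescaling and the logarithm\<close>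

lemma compose_X_power_nth:
  fixes b q :: "'a :: idom fps"
  assumes "c \<le> n"
  shows "fps_nth (fps_X ^ c * q oo b) n = (\<Sum>j=0..n-c. fps_nth q j * fps_nth (b ^ (c + j)) n)"
proof -
  have "fps_nth (fps_X ^ c * q oo b) n = (\<Sum>i\<in>{c..n}. fps_nth q (i - c) * fps_nth (b ^ i) n)"
    unfolding fps_compose_nth fps_X_power_mult_nth
    by (intro sum.mono_neutral_cong_right) auto
  also have "\<dots> = (\<Sum>j=0..n-c. fps_nth q j * fps_nth (b ^ (c + j)) n)"
    by (rule sum.reindex_bij_witness[of _ "\<lambda>j. c + j" "\<lambda>i. i - c"]) (use assms in auto)
  finally show ?thesis .
qed

lemma Ints_fps_power:
  fixes q :: "'a :: comm_ring_1 fps"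
  assumes "\<And>i. fps_nth q i \<in> \<int>"
  shows "fps_nth (q ^ c) i \<in> \<int>"
proof (induction c arbitrary: i)
  case (Suc c)
  thus ?case using assms by (auto simp: fps_mult_nth intro!: Ints_sum Ints_mult)
qed auto

lemma expm1_power_nth_less: "n < c \<Longrightarrow> fps_nth (expm1 ^ c) n = 0"
  using startsby_zero_power_prefix[of expm1 c] by simp

text \<open>Substituting at for t turns E into (1 + E)^a - 1, an integral polynomial in E with
  lowest term a E.\<close>

lemma expm1_power_rescale:
  fixes a c :: nat
  obtains q :: "rat fps" where "\<And>i. fps_nth q i \<in> \<int>" "fps_nth q 0 = of_nat a ^ c"
    "\<And>n. c \<le> n \<Longrightarrow> of_nat a ^ n * fps_nth (expm1 ^ c) n =
       (\<Sum>j=0..n-c. fps_nth q j * fps_nth (expm1 ^ (c + j)) n)"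
proof
  \<comment> \<open>Composing \<open>s\<close> with E gives e^(at) - 1, and \<open>r\<close> is
    \<open>s\<close> with its factor \<open>fps_X\<close> removed.\<close>
  define s :: "rat fps" where "s = (1 + fps_X) ^ a - 1"
  define r where "r = fps_shift 1 s"
  have s_Ints: "fps_nth s i \<in> \<int>" for i
  proof -
    have "fps_nth (1 + fps_X :: rat fps) i \<in> \<int>" for i by (simp add: fps_X_def)
    thus ?thesis unfolding s_def by (auto intro!: Ints_diff Ints_fps_power)
  qed
  thus "\<And>i. fps_nth (r ^ c) i \<in> \<int>"
    by (intro Ints_fps_power) (simp add: r_def)
  have s0: "fps_nth s 0 = 0" by (simp add: s_def fps_power_zeroth)
  have s1: "fps_nth s 1 = of_nat a"
  proof -
    have "fps_nth ((1 + fps_X) ^ a :: rat fps) 1 = of_nat a"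
      by (induction a) (simp_all add: fps_mult_nth fps_power_zeroth)
    thus ?thesis unfolding s_def by simp
  qed
  show "fps_nth (r ^ c) 0 = of_nat a ^ c"
    using s1 by (simp add: fps_power_zeroth r_def)
  have Xr: "s = fps_X * r"
  proof (rule fps_ext)
    fix i show "fps_nth s i = fps_nth (fps_X * r) i"
      using s0 by (cases i) (simp_all add: r_def)
  qed
  fix n assume "c \<le> n"
  have X: "fps_X oo expm1 = expm1" by (rule fps_X_fps_compose_startby0) simp
  have "s oo expm1 = (1 + expm1) ^ a - 1"
    unfolding s_def fps_compose_sub_distrib
    by (simp add: fps_compose_power[symmetric] fps_compose_add_distrib X)
  also have "\<dots> = fps_exp (of_nat a) - 1" by (simp add: fps_exp_power_mult)
  also have "\<dots> = expm1 oo (fps_const (of_nat a) * fps_X)"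
    by (simp add: fps_compose_sub_distrib)
  finally have "(expm1 oo (fps_const (of_nat a) * fps_X)) ^ c = (s oo expm1) ^ c" by simp
  hence "expm1 ^ c oo (fps_const (of_nat a) * fps_X) = fps_X ^ c * r ^ c oo expm1"
    by (simp add: fps_compose_power Xr power_mult_distrib)
  hence "fps_nth (expm1 ^ c oo (fps_const (of_nat a) * fps_X)) n = fps_nth (fps_X ^ c * r ^ c oo expm1) n"
    by simp
  thus "of_nat a ^ n * fps_nth (expm1 ^ c) n =
       (\<Sum>j=0..n-c. fps_nth (r ^ c) j * fps_nth (expm1 ^ (c + j)) n)"
    unfolding compose_X_power_nth[OF \<open>c \<le> n\<close>] by (simp add: fps_compose_linear)
qed

text \<open>The Euler identity with d = 1 gives (n/k) L(E^k) = L(t E^(k-1) e^t). Here t e^t = (1 +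
  E) log (1 + E) is expanded in powers of E; the term j = 0 moves to the left side.\<close>

lemma expm1_power_log:
  assumes "0 < k" "k \<le> n"
  shows "(of_nat n / of_nat k - 1) * fps_nth (expm1 ^ k) n =
    (\<Sum>j=1..n-k. (-1) ^ (j + 1) / of_nat (j * (j + 1)) * fps_nth (expm1 ^ (k + j)) n)"
proof -
  define L :: "rat fps" where
    "L = Abs_fps (\<lambda>j. if j = 0 then 1 else (-1) ^ (j + 1) / of_nat (j * (j + 1)))"
  have L: "fps_ln 1 * (1 + fps_X) = fps_X * L"
  proof (rule fps_ext)
    fix i show "fps_nth (fps_ln 1 * (1 + fps_X)) i = fps_nth (fps_X * L) i"
    proof (cases i)
      case (Suc j)
      have "fps_nth (fps_ln 1 * (1 + fps_X)) i = fps_nth (fps_ln 1) (Suc j) + fps_nth (fps_ln (1 :: rat)) j"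
        unfolding Suc by (simp add: distrib_left)
      also have "\<dots> = fps_nth L j"
      proof (cases j)
        case (Suc l)
        \<comment> \<open>Multiplying the logarithm by 1 + X subtracts neighbouring reciprocals,
          whence the denominators j (j + 1).\<close>
        have "(-1) ^ l / (of_nat l + 1) - (-1) ^ l / (of_nat l + 2) =
            ((-1) ^ l / ((of_nat l + 1) * (of_nat l + 2)) :: rat)"
        proof -
          have "(of_nat l + 1 :: rat) \<noteq> 0" "(of_nat l + 2 :: rat) \<noteq> 0"
            by (metis of_nat_Suc of_nat_neq_0 add.commute, metis of_nat_Suc of_nat_neq_0 add.commute one_add_one add.assoc)
          thus ?thesis by (simp add: diff_frac_eq algebra_simps)
        qed
        thus ?thesis by (simp add: Suc fps_ln_nth L_def algebra_simps)
      qed (simp add: fps_ln_nth L_def)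
      also have "\<dots> = fps_nth (fps_X * L) i" unfolding Suc by simp
      finally show ?thesis .
    qed simp
  qed
  have X: "fps_X oo expm1 = expm1" by (rule fps_X_fps_compose_startby0) simp
  have ln: "fps_ln 1 oo expm1 = fps_X"
    unfolding fps_ln_fps_exp_inv[OF one_neq_zero] by (rule fps_inv_fps_exp_compose) simp
  have "fps_X * expm1 ^ (k - 1) * fps_exp 1 = fps_X ^ (k - 1) * (fps_ln 1 * (1 + fps_X)) oo expm1"
    by (simp add: fps_compose_mult_distrib fps_compose_power[symmetric] fps_compose_add_distrib X ln)
  also have "fps_X ^ (k - 1) * (fps_ln 1 * (1 + fps_X)) = fps_X ^ k * L"
    unfolding L using assms(1) by (cases k) simp_all
  finally have "fps_nth (fps_X * expm1 ^ (k - 1) * fps_exp 1) n =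
      (\<Sum>j=0..n-k. fps_nth L j * fps_nth (expm1 ^ (k + j)) n)"
    using compose_X_power_nth[OF assms(2)] by simp
  also have "\<dots> = fps_nth (expm1 ^ k) n +
      (\<Sum>j=1..n-k. (-1) ^ (j + 1) / of_nat (j * (j + 1)) * fps_nth (expm1 ^ (k + j)) n)"
    by (subst sum.atLeast_Suc_atMost) (auto simp: L_def intro!: sum.cong)
  finally show ?thesis
    using euler_expm1_power[OF assms(1), of n 1] assms(1)
    by (simp add: field_simps)
qed

section \<open>Descent by a primitive root\<close>

context fixed_prime begin

lemma plocal_cancel_int:
  assumes "of_int b * x \<in> plocal p" "\<not> int p dvd b"
  shows "x \<in> plocal p"
proof -
  have "b \<noteq> 0" using assms(2) by auto
  with plocal_divide_int[OF assms] show ?thesis by simp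
qed

text \<open>With c = k + i, rescaling by a primitive root a writes (a^n - a^c) L(E^c) through higher
  powers of E. Were a^n - a^c divisible by p, then p - 1 would divide n - c, hence i, contrary to 0
  < i < p - 1.\<close>

lemma rescale_step:
  assumes "(p - 1) dvd (n - k)" "0 < i" "i < p - 1"
  assumes "\<And>j. j > i \<Longrightarrow> g * fps_nth (expm1 ^ (k + j)) n / of_nat p \<in> plocal p"
  shows "g * fps_nth (expm1 ^ (k + i)) n / of_nat p \<in> plocal p"
proof (cases "k + i \<le> n")
  case False
  thus ?thesis by (simp add: expm1_power_nth_less)
next
  case True
  define c where "c = k + i"
  obtain a where a: "coprime p a" "ord p a = p - 1"
    using prime_primitive_root_exists[of p] prime_p prime_gt_1_nat[OF prime_p]
    by (auto simp: residue_primroot_def totient_prime)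
  obtain q :: "rat fps" where q: "\<And>i. fps_nth q i \<in> \<int>" "fps_nth q 0 = of_nat a ^ c"
    "\<And>n. c \<le> n \<Longrightarrow> of_nat a ^ n * fps_nth (expm1 ^ c) n =
       (\<Sum>j=0..n-c. fps_nth q j * fps_nth (expm1 ^ (c + j)) n)"
    by (rule expm1_power_rescale[of a c]) (rule that)
  have split: "of_nat a ^ n * fps_nth (expm1 ^ c) n - of_nat a ^ c * fps_nth (expm1 ^ c) n =
      (\<Sum>j=1..n-c. fps_nth q j * fps_nth (expm1 ^ (c + j)) n)"
    unfolding q(3)[OF True[folded c_def]] by (subst sum.atLeast_Suc_atMost) (auto simp: q(2))
  have "of_int (int a ^ n - int a ^ c) * (g * fps_nth (expm1 ^ c) n / of_nat p) =
     (of_nat a ^ n * fps_nth (expm1 ^ c) n - of_nat a ^ c * fps_nth (expm1 ^ c) n) * (g / of_nat p)"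
    by (simp add: algebra_simps diff_divide_distrib)
  also have "\<dots> = (\<Sum>j=1..n-c. fps_nth q j * (g * fps_nth (expm1 ^ (k + (i + j))) n / of_nat p))"
    unfolding split sum_distrib_right
    by (intro sum.cong) (simp_all add: c_def add.assoc)
  also have "\<dots> \<in> plocal p"
  proof (intro plocal_sum plocal_mult assms(4))
    fix j show "fps_nth q j \<in> plocal p" using q(1)[of j] by (auto elim!: Ints_cases)
  qed auto
  finally have "of_int (int a ^ n - int a ^ c) * (g * fps_nth (expm1 ^ c) n / of_nat p) \<in> plocal p" .
  moreover have "\<not> int p dvd int a ^ n - int a ^ c"
  proof
    assume "int p dvd int a ^ n - int a ^ c"
    hence "[a ^ n = a ^ c] (mod p)"
      unfolding cong_int_iff[symmetric] by (simp add: cong_iff_dvd_diff)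
    hence "[n = c] (mod (p - 1))"
      using order_divides_expdiff[OF a(1), of n c] a(2) by simp
    hence "(p - 1) dvd n - c"
      using True unfolding c_def by (simp add: cong_altdef_nat)
    moreover have "n - k = (n - c) + i" using True unfolding c_def by simp
    ultimately have "(p - 1) dvd i" using assms(1) by (metis dvd_add_right_iff)
    thus False using assms(2,3) by (simp add: nat_dvd_not_less)
  qed
  ultimately show ?thesis unfolding c_def by (rule plocal_cancel_int)
qed

lemma rescale_descent:
  assumes "(p - 1) dvd (n - k)"
  assumes "\<And>j. j \<ge> p - 1 \<Longrightarrow> g * fps_nth (expm1 ^ (k + j)) n / of_nat p \<in> plocal p"
  shows "g * fps_nth (expm1 ^ (k + 1)) n / of_nat p \<in> plocal p"
proof -
  have "1 \<le> p - 1" using prime_gt_1_nat[OF prime_p] by simp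
  hence "\<forall>j\<ge>1. g * fps_nth (expm1 ^ (k + j)) n / of_nat p \<in> plocal p"
  proof (induction rule: inc_induct)
    case base
    thus ?case using assms(2) by blast
  next
    case (step i)
    have ge: "g * fps_nth (expm1 ^ (k + j)) n / of_nat p \<in> plocal p" if "j > i" for j
      using step.IH that by simp
    have "g * fps_nth (expm1 ^ (k + i)) n / of_nat p \<in> plocal p"
      using step.hyps by (intro rescale_step[OF assms(1) _ _ ge]) simp_all
    with ge show ?case by (auto simp: le_less)
  qed
  thus ?thesis by blast
qed

subsection \<open>Divisibility of the top coefficients\<close>

text \<open>At most one of j and j + 1 is divisible by p. The bound fails at both exclusions: for j
  = p - 1 it reads 1 <= 0, and for p = 2, j = 3 it reads 2 <= 1.\<close>

lemma multiplicity_consecutive: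
  assumes "0 < j" "j \<noteq> p - 1" "\<not> (p = 2 \<and> j = 3)"
  shows "multiplicity p (j * (j + 1)) \<le> j div p"
proof -
  have p2: "p \<ge> 2" using prime_ge_2_nat[OF prime_p] .
  consider "\<not> p dvd j" "\<not> p dvd j + 1" | "p dvd j" "\<not> p dvd j + 1" | "\<not> p dvd j" "p dvd j + 1"
    using prime_p by (metis dvd_add_right_iff not_prime_unit)
  thus ?thesis
  proof cases
    case 1
    hence "\<not> p dvd j * (j + 1)" using prime_p prime_dvd_mult_iff by blast
    thus ?thesis by (simp add: not_dvd_imp_multiplicity_0)
  next
    case 2
    have "multiplicity p (j * (j + 1)) = multiplicity p j"
      using 2 assms(1) prime_p
      by (subst prime_elem_multiplicity_mult_distrib) (auto simp: not_dvd_imp_multiplicity_0)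
    also have "\<dots> \<le> j div p"
    proof -
      obtain r where r: "j = p ^ multiplicity p j * r" "\<not> p dvd r"
        using multiplicity_decompose'[of j p] assms(1) prime_p by (metis gr_implies_not0 not_prime_unit)
      obtain m where m: "multiplicity p j = Suc m"
        using 2 assms(1) prime_p by (metis gr_implies_not0 multiplicity_gt_zero_iff not_prime_unit not0_implies_Suc)
      have "r > 0" using r(2) by (cases r) auto
      have "Suc m \<le> p ^ m" using power_gt_expt[of p m] p2 by simp
      also have "\<dots> \<le> p ^ m * r" using \<open>r > 0\<close> by simp
      also have "p ^ m * r = j div p"
        using p2 by (subst r(1)) (simp add: m)
      finally show ?thesis using m by simp
    qed
    finally show ?thesis .
  next
    case 3
    have "multiplicity p (j * (j + 1)) = multiplicity p (j + 1)"
      using 3 assms(1) prime_p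
      by (subst prime_elem_multiplicity_mult_distrib) (auto simp: not_dvd_imp_multiplicity_0)
    also have "\<dots> \<le> j div p"
    proof -
      obtain r where r: "j + 1 = p ^ multiplicity p (j + 1) * r" "\<not> p dvd r"
        using multiplicity_decompose'[of "j + 1" p] prime_p by (metis Suc_eq_plus1 Zero_neq_Suc not_prime_unit)
      obtain m where m: "multiplicity p (j + 1) = Suc m"
        using 3 prime_p by (metis Suc_eq_plus1 Zero_neq_Suc gr_implies_not0 multiplicity_gt_zero_iff not_prime_unit not0_implies_Suc)
      have "r > 0" using r(2) by (cases r) auto
      have j: "j + 1 = p * (p ^ m * r)" using r(1) by (metis m power_Suc mult.assoc)
      have "p ^ m * r > 0" using \<open>r > 0\<close> p2 by simp
      then obtain s where s: "p ^ m * r = Suc s" using gr0_implies_Suc by blast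
      have "j div p = s" using j p2 unfolding s by (intro div_nat_eqI) simp_all
      hence "j div p = p ^ m * r - 1" using s by simp
      \<comment> \<open>Equality \<open>j div p = p ^ m * r - 1\<close> reduces the bound to this.
        With r = 1 it fails only for m = 0 and for p = 2, m = 1, the two excluded values of
        j.\<close>
      moreover have "m + 2 \<le> p ^ m * r"
      proof (cases "m = 0")
        case True
        have "r \<noteq> 1" using j assms(2) True by auto
        thus ?thesis using \<open>r > 0\<close> True by simp
      next
        case False
        show ?thesis
        proof (cases "p = 2")
          case True
          show ?thesis
          proof (cases "m = 1")
            case m1: True
            have "r \<noteq> 1" using j assms(3) True m1 by auto
            thus ?thesis using \<open>r > 0\<close> True m1 by simp
          next
            case m2: False
            have "m' + 4 \<le> 2 ^ (m' + 2)" for m' :: nat by (induction m') auto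
            moreover have "m - 2 + 2 = m" using m2 False by simp
            ultimately have "m + 2 \<le> 2 ^ m" by (metis add.assoc numeral_plus_numeral semiring_norm(2,6) add_numeral_left)
            also have "\<dots> \<le> 2 ^ m * r" using \<open>r > 0\<close> by simp
            finally show ?thesis using True by simp
          qed
        next
          case p3: False
          have *: "Suc m' + 2 \<le> 3 ^ Suc m'" for m' :: nat by (induction m') auto
          have "m + 2 \<le> 3 ^ m" using *[of "m - 1"] False by simp
          also have "\<dots> \<le> p ^ m" using p2 p3 by (intro power_mono) auto
          also have "\<dots> \<le> p ^ m * r" using \<open>r > 0\<close> by simp
          finally show ?thesis .
        qed
      qed
      ultimately show ?thesis using m by simp
    qed
    finally show ?thesis .
  qed
qed

text \<open>Each full block of p exponents gains a factor p; the remaining \<open>j mod p\<close>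
  factors E are Hurwitz.\<close>

lemma expm1_gain_nth:
  assumes "p dvd k" "pairs_integrally p n (fps_const g * expm1 ^ k)"
  shows "g * fps_nth (expm1 ^ (k + j)) n / of_nat p ^ (j div p) \<in> plocal p"
proof -
  have "pairs_integrally p n (fps_const (g / of_nat p ^ (j div p)) * expm1 ^ (k + j div p * p) * expm1 ^ (j mod p))"
    by (intro pairs_integrally_mult pairs_integrally_gain_iter assms hurwitz_power hurwitz_expm1)
  hence "fps_nth (fps_const (g / of_nat p ^ (j div p)) * (expm1 ^ (k + j div p * p) * expm1 ^ (j mod p))) n \<in> plocal p"
    by (simp only: pairs_integrally_nth flip: mult.assoc)
  moreover have "expm1 ^ (k + j div p * p) * expm1 ^ (j mod p) = expm1 ^ (k + j)"
    by (simp only: add.assoc div_mult_mod_eq flip: power_add)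
  ultimately show ?thesis by simp
qed

text \<open>Dividing the \<open>j\<close>-th term by \<open>j (j + 1)\<close> is harmless because \<open>E\<^bsup>k + j\<^esup>\<close> is divisible by
  \<open>p\<^bsup>j div p\<^esup>\<close>, except at \<open>j = p - 1\<close>, which is thereby isolated, and at \<open>j = 3\<close> for \<open>p = 2\<close>.\<close>

lemma top_term_of_dvd:
  assumes "p dvd k" "0 < k" "pairs_integrally p n (fps_const g * expm1 ^ k)"
  assumes "of_nat n / of_nat k \<in> plocal p"
  assumes "p = 2 \<Longrightarrow> g * fps_nth (expm1 ^ (k + 3)) n / 4 \<in> plocal p"
  shows "g * fps_nth (expm1 ^ (k + (p - 1))) n / of_nat p \<in> plocal p"
proof (cases "k + (p - 1) \<le> n")
  case False
  thus ?thesis by (simp add: expm1_power_nth_less)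
next
  case True
  have p2: "p \<ge> 2" using prime_ge_2_nat[OF prime_p] .
  define f where "f j = g * fps_nth (expm1 ^ (k + j)) n / of_nat (j * (j + 1))" for j
  have f: "f j \<in> plocal p" if "0 < j" "j \<noteq> p - 1" for j
  proof (cases "p = 2 \<and> j = 3")
    case True
    have "f j = (g * fps_nth (expm1 ^ (k + 3)) n / 4) / of_nat 3" using True by (simp add: f_def)
    also have "\<dots> \<in> plocal p" using assms(5) True by (intro plocal_divide_nat) auto
    finally show ?thesis .
  next
    case False
    have "f j = (g * fps_nth (expm1 ^ (k + j)) n / of_nat p ^ (j div p)) *
        (of_nat p ^ (j div p) / of_nat (j * (j + 1)))"
      unfolding f_def using p2 by simp
    also have "\<dots> \<in> plocal p"
      using multiplicity_consecutive[OF that False] that(1)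
      by (intro plocal_mult expm1_gain_nth assms plocal_power_div_nat) auto
    finally show ?thesis .
  qed
  have "(of_nat n / of_nat k - 1) * (g * fps_nth (expm1 ^ k) n) =
      g * (\<Sum>j=1..n-k. (-1) ^ (j + 1) / of_nat (j * (j + 1)) * fps_nth (expm1 ^ (k + j)) n)"
    using expm1_power_log[OF assms(2), of n] True by (simp add: mult_ac)
  also have "\<dots> = (\<Sum>j=1..n-k. (-1) ^ (j + 1) * f j)"
    unfolding sum_distrib_left f_def by (intro sum.cong refl) simp
  also have "\<dots> = (-1) ^ (p - 1 + 1) * f (p - 1) + (\<Sum>j\<in>{1..n-k} - {p - 1}. (-1) ^ (j + 1) * f j)"
    using True p2 by (intro sum.remove) auto
  finally have "(-1) ^ (p - 1 + 1) * f (p - 1) =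
      (of_nat n / of_nat k - 1) * (g * fps_nth (expm1 ^ k) n) -
      (\<Sum>j\<in>{1..n-k} - {p - 1}. (-1) ^ (j + 1) * f j)" by simp
  also have "\<dots> \<in> plocal p"
  proof -
    have "g * fps_nth (expm1 ^ k) n \<in> plocal p" using pairs_integrally_nth[OF assms(3)] by simp
    hence "(of_nat n / of_nat k - 1) * (g * fps_nth (expm1 ^ k) n) \<in> plocal p"
      using assms(4) by auto
    moreover have "(\<Sum>j\<in>{1..n-k} - {p - 1}. (-1) ^ (j + 1) * f j) \<in> plocal p"
      by (intro plocal_sum plocal_mult plocal_power f) auto
    ultimately show ?thesis by auto
  qed
  finally have "f (p - 1) \<in> plocal p"
    by (cases "even (p - 1 + 1)") (auto simp: minus_one_power_iff)
  \<comment> \<open>The denominator of \<open>f (p - 1)\<close> is (p - 1) p; clearing p - 1 leaves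
    just p.\<close>
  hence "of_nat (p - 1) * f (p - 1) \<in> plocal p" by auto
  moreover have "of_nat (p - 1) * f (p - 1) = g * fps_nth (expm1 ^ (k + (p - 1))) n / of_nat p"
    unfolding f_def using p2 by (simp add: of_nat_diff)
  ultimately show ?thesis by simp
qed

text \<open>For \<open>p = 2\<close> the Euler operator is applied with the even series \<open>sinh t / t\<close>.\<close>

lemma gain_two:
  assumes "p = 2" "c mod 4 = 2" "even n" "pairs_integrally p n (fps_const g * expm1 ^ c)"
  shows "g * fps_nth (expm1 ^ (c + 1)) n / 2 \<in> plocal p"
proof -
  \<comment> \<open>This is sinh t / t. Only even powers occur, so j + 1 is odd and invertible at 2,
    and t d' is twice the Hurwitz series \<open>e\<close>.\<close>
  define d :: "rat fps" where "d = Abs_fps (\<lambda>j. if even j then 1 / fact (j + 1) else 0)"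
  define e :: "rat fps" where "e = Abs_fps (\<lambda>j. if even j then of_nat (j div 2) / fact (j + 1) else 0)"
  have odd_div: "x / of_nat (j + 1) \<in> plocal p" if "x \<in> plocal p" "even j" for x j
    using that assms(1) by (intro plocal_divide_nat) auto
  have d: "d \<in> hurwitz p"
  proof (rule hurwitzI)
    fix i
    have "fact i * fps_nth d i = (if even i then 1 / of_nat (i + 1) else 0)" by (simp add: d_def)
    thus "fact i * fps_nth d i \<in> plocal p" using odd_div[OF plocal_1, of i] by simp
  qed
  have e: "e \<in> hurwitz p"
  proof (rule hurwitzI)
    fix i
    have "fact i * fps_nth e i = (if even i then of_nat (i div 2) / of_nat (i + 1) else 0)"
      by (simp add: e_def)
    thus "fact i * fps_nth e i \<in> plocal p"
      using odd_div[OF plocal_of_nat, of i "i div 2"] by (simp split: if_splits)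
  qed
  have de: "fps_X * fps_deriv d = fps_const 2 * e"
  proof (rule fps_ext)
    fix i
    show "fps_nth (fps_X * fps_deriv d) i = fps_nth (fps_const 2 * e) i"
      unfolding X_deriv_nth by (auto simp: d_def e_def elim!: evenE)
  qed
  have sinh: "fps_const 2 * (fps_X * d) = fps_exp 1 - fps_exp (- 1)"
  proof (rule fps_ext)
    fix i
    show "fps_nth (fps_const 2 * (fps_X * d)) i = fps_nth (fps_exp 1 - fps_exp (- 1)) i"
      by (cases i) (auto simp: d_def algebra_simps)
  qed
  have "c > 0" using assms(2) by (cases c) auto
  obtain c' where c': "c = 2 * c'" "odd c'"
  proof -
    have "c = 2 * (2 * (c div 4) + 1)" using assms(2) by presburger
    thus ?thesis by (rule that) simp
  qed
  obtain n' where n': "n = 2 * n'" using assms(3) by (elim evenE)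
  define A where "A = g * fps_nth (fps_X * expm1 ^ (c - 1) * fps_exp 1 * d) n"
  have "of_nat n * (g * fps_nth (expm1 ^ c * d) n) =
      of_nat c * A + 2 * (g * fps_nth (expm1 ^ c * e) n)"
    using arg_cong[where f = "\<lambda>x. g * x", OF euler_expm1_power[OF \<open>c > 0\<close>, of n d]]
    unfolding de mult.left_commute[of _ "fps_const 2"] fps_mult_left_const_nth A_def
    by (simp only: algebra_simps)
  \<comment> \<open>All three terms are even, so cancelling 2 leaves the odd multiplier
    \<open>c'\<close> on \<open>A\<close>.\<close>
  hence "of_nat c' * A = of_nat n' * (g * fps_nth (expm1 ^ c * d) n) - g * fps_nth (expm1 ^ c * e) n"
    by (simp add: c'(1) n' algebra_simps)
  also have "\<dots> \<in> plocal p"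
  proof -
    have "g * fps_nth (expm1 ^ c * d) n \<in> plocal p" "g * fps_nth (expm1 ^ c * e) n \<in> plocal p"
      using pairs_integrallyD[OF assms(4) d] pairs_integrallyD[OF assms(4) e]
      by (simp_all add: mult.assoc)
    thus ?thesis by (intro plocal_diff plocal_mult[OF plocal_of_nat])
  qed
  finally have A: "A \<in> plocal p"
    by (rule plocal_cancel_nat) (use c'(2) assms(1) in simp)
  \<comment> \<open>By \<open>sinh\<close> the difference of exponentials is 2 t d, so E^2 acquires
    an explicit factor 2.\<close>
  have "expm1 ^ 2 = fps_exp 1 * (fps_exp 1 - fps_exp (- 1)) - fps_const 2 * expm1"
  proof -
    have "fps_exp 1 * fps_exp (- 1) = (1 :: rat fps)" by (simp flip: fps_exp_add_mult)
    thus ?thesis unfolding numeral_fps_const[symmetric]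
      by (simp add: power2_eq_square algebra_simps)
  qed
  hence "expm1 ^ (c + 1) =
    fps_const 2 * (fps_X * expm1 ^ (c - 1) * fps_exp 1 * d) - fps_const 2 * expm1 ^ c"
  proof -
    assume *: "expm1 ^ 2 = fps_exp 1 * (fps_exp 1 - fps_exp (- 1)) - fps_const 2 * expm1"
    have "expm1 ^ (c + 1) = expm1 ^ (c - 1) * expm1 ^ 2"
      using \<open>c > 0\<close> by (simp flip: power_add)
    also have "\<dots> = expm1 ^ (c - 1) * (fps_exp 1 * (fps_const 2 * (fps_X * d))) -
        expm1 ^ (c - 1) * (fps_const 2 * expm1)"
      unfolding * sinh by (simp only: right_diff_distrib)
    also have "expm1 ^ (c - 1) * (fps_const 2 * expm1) = fps_const 2 * expm1 ^ c"
      using \<open>c > 0\<close> by (cases c) (simp_all add: mult_ac)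
    finally show ?thesis by (simp only: mult_ac)
  qed
  hence "fps_nth (expm1 ^ (c + 1)) n =
     2 * fps_nth (fps_X * expm1 ^ (c - 1) * fps_exp 1 * d) n - 2 * fps_nth (expm1 ^ c) n"
    by (simp only: fps_sub_nth fps_mult_left_const_nth)
  hence "g * fps_nth (expm1 ^ (c + 1)) n / 2 = A - g * fps_nth (expm1 ^ c) n"
    by (simp only: A_def) (simp add: algebra_simps diff_divide_distrib)
  also have "\<dots> \<in> plocal p"
    using A pairs_integrally_nth[OF assms(4)] by auto
  finally show ?thesis .
qed

text \<open>For k prime to p a single gain suffices. Otherwise the logarithm is used, except for p =
  2 and k = 2 mod 4, where \<open>gain_two\<close> applies directly.\<close>

lemma top_term:
  assumes "0 < k" "pairs_integrally p n (fps_const g * expm1 ^ k)"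
  assumes "of_nat n / of_nat k \<in> plocal p"
  shows "g * fps_nth (expm1 ^ (k + (p - 1))) n / of_nat p \<in> plocal p"
proof (cases "p dvd k")
  case False
  have "pairs_integrally p n (fps_const (g / of_nat p) * expm1 ^ (k - 1 + p))"
    by (rule pairs_integrally_gain[OF assms(1) False assms(2)])
  moreover have "k - 1 + p = k + (p - 1)" using assms(1) prime_gt_0_nat[OF prime_p] by simp
  ultimately have "fps_nth (fps_const (g / of_nat p) * expm1 ^ (k + (p - 1))) n \<in> plocal p"
    using pairs_integrally_nth by metis
  thus ?thesis by simp
next
  case True
  have n: "p dvd n" using dvd_of_plocal_quotient[OF assms(3) True assms(1)] .
  show ?thesis
  proof (cases "p = 2 \<and> k mod 4 = 2")
    case two: True
    with n have "even n" by simp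
    thus ?thesis using gain_two[of k n g] two assms(2) by simp
  next
    case False
    show ?thesis
    proof (rule top_term_of_dvd[OF True assms(1-3)])
      assume p: "p = 2"
      hence k: "k mod 4 = 0" "even k" using False True by presburger+
      \<comment> \<open>One gain moves the exponent to k + 2, which is 2 mod 4;
        \<open>gain_two\<close> then yields the second factor 2 at k + 3.\<close>
      have "pairs_integrally p n (fps_const (g / 2) * expm1 ^ (k + 2))"
        using pairs_integrally_gain_iter[OF True assms(2), of 1] p by simp
      hence "g / 2 * fps_nth (expm1 ^ (k + 2 + 1)) n / 2 \<in> plocal p"
        using k n p by (intro gain_two) (auto, presburger)
      thus "g * fps_nth (expm1 ^ (k + 3)) n / 4 \<in> plocal p" by (simp add: numeral_3_eq_3)
    qed
  qed
qed

end

subsection \<open>Bernoulli polynomials and Stirling numbers\<close>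

text \<open>The derivative k (E^k + E^(k-1)) of E^k reproduces the Stirling recurrence.\<close>

lemma fact_mult_expm1_power_nth:
  "fact n * fps_nth (expm1 ^ k) n = fact k * of_nat (Stirling n k)"
proof (induction n arbitrary: k)
  case 0
  thus ?case by (cases k) auto
next
  case (Suc n)
  show ?case
  proof (cases k)
    case (Suc l)
    have "of_nat (Suc n) * fps_nth (expm1 ^ k) (Suc n) = fps_nth (fps_deriv (expm1 ^ k)) n"
      by (simp del: of_nat_Suc)
    also have "fps_deriv (expm1 ^ k) = fps_const (of_nat k) * (expm1 ^ k + expm1 ^ l)"
    proof -
      have "expm1 ^ k + expm1 ^ l = expm1 ^ l * fps_exp 1"
        unfolding Suc by (simp add: algebra_simps)
      thus ?thesis by (simp add: Suc fps_deriv_power' mult_ac fps_of_nat del: power_Suc of_nat_Suc)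
    qed
    also have "fps_nth \<dots> n = of_nat k * (fps_nth (expm1 ^ k) n + fps_nth (expm1 ^ l) n)"
      by simp
    finally have "fact n * (of_nat (Suc n) * fps_nth (expm1 ^ k) (Suc n)) =
        of_nat k * (fact n * fps_nth (expm1 ^ k) n + fact n * fps_nth (expm1 ^ l) n)"
      by (simp only: algebra_simps)
    also have "\<dots> = of_nat k * (fact k * of_nat (Stirling n k) + fact l * of_nat (Stirling n l))"
      by (simp only: Suc.IH)
    also have "\<dots> = fact k * of_nat (Stirling (Suc n) k)"
      by (simp add: Suc algebra_simps)
    finally show ?thesis by (simp add: algebra_simps)
  qed simp
qed

lemma expm1_eq_X_mult: "expm1 = fps_X * fps_shift 1 expm1"
proof (rule fps_ext)
  fix i show "fps_nth expm1 i = fps_nth (fps_X * fps_shift 1 expm1) i" by (cases i) simp_all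
qed

lemma bernoulli_gen_uminus: "bernoulli_gen (- int k) = fps_shift 1 expm1 ^ k"
proof -
  define f where "f = fps_shift 1 expm1"
  have f0: "fps_nth f 0 = 1" by (simp add: f_def)
  hence fz: "f \<noteq> 0" by auto
  have "fps_X / expm1 = (fps_X * 1) / (fps_X * f)"
    unfolding f_def by (subst expm1_eq_X_mult) simp
  also have "\<dots> = 1 / f" by (rule div_mult_mult1) simp
  also have "\<dots> = inverse f" using f0 by (simp add: fps_divide_unit)
  finally have "bernoulli_gen (- int k) = inverse f powi (- int k)"
    by (simp add: bernoulli_gen_def)
  also have "\<dots> = f ^ k"
    using f0 by (cases "k = 0") (simp_all add: power_int_def)
  finally show ?thesis unfolding f_def .
qed

lemma coeff_ho_bernpoly:
  "coeff (ho_bernpoly m l) j = (if j \<le> m then fact m / fact j * fps_nth (bernoulli_gen l) (m - j) else 0)"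
proof -
  have "coeff (ho_bernpoly m l) j =
    fact m * (\<Sum>i=0..m. if m - i = j then fps_nth (bernoulli_gen l) i / fact j else 0)"
    unfolding ho_bernpoly_def bernoulli_poly_gen_def coeff_smult fps_mult_nth coeff_sum
    by (intro arg_cong2[where f = "(*)"] sum.cong refl) (auto simp: smult_monom)
  also have "(\<Sum>i=0..m. if m - i = j then fps_nth (bernoulli_gen l) i / fact j else 0) =
      (if j \<le> m then fps_nth (bernoulli_gen l) (m - j) / fact j else 0)"
  proof (cases "j \<le> m")
    case True
    have "(\<Sum>i=0..m. if m - i = j then fps_nth (bernoulli_gen l) i / fact j else 0) =
      (\<Sum>i=0..m. if i = m - j then fps_nth (bernoulli_gen l) i / fact j else 0)"
      using True by (intro sum.cong refl) auto
    thus ?thesis using True by simp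
  qed (auto intro!: sum.neutral)
  finally show ?thesis by simp
qed

text \<open>For order -k the generating function is (E/t)^k, so the coefficients of B are the
  quantities tested in \<open>pairs_integrally_coeffs\<close>.\<close>

lemma coeff_ho_bernpoly_uminus:
  assumes "k \<le> n"
  shows "coeff (ho_bernpoly (n - k) (- int k)) j =
    (if j \<le> n - k then fact (n - k) / fact j * fps_nth (expm1 ^ k) (n - j) else 0)"
proof -
  have "fps_nth (fps_shift 1 expm1 ^ k) (n - k - j) = fps_nth (expm1 ^ k) (n - j)" if "j \<le> n - k"
  proof -
    have "expm1 ^ k = fps_X ^ k * fps_shift 1 expm1 ^ k"
      by (subst expm1_eq_X_mult) (rule power_mult_distrib)
    hence "fps_nth (expm1 ^ k) (n - j) = fps_nth (fps_shift 1 expm1 ^ k) (n - j - k)"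
      unfolding fps_X_power_mult_nth using that assms by (metis fps_X_power_mult_nth diff_le_mono2 diff_diff_cancel not_less)
    thus ?thesis by (simp add: add.commute)
  qed
  thus ?thesis unfolding coeff_ho_bernpoly bernoulli_gen_uminus by simp
qed

section \<open>The p-adic valuation of rationals\<close>

context fixed_prime begin

text \<open>Frees the valuation from lowest terms, as multiplicativity requires.\<close>

lemma rat_val_quotient:
  assumes "a \<noteq> 0" "b \<noteq> 0"
  shows "rat_val p (of_int a / of_int b) = int (multiplicity (int p) a) - int (multiplicity (int p) b)"
proof -
  obtain c d where cd: "quotient_of (of_int a / of_int b) = (c, d)" by fastforce
  have d: "d > 0" using quotient_of_denom_pos[OF cd] .
  have "of_int a / of_int b = (of_int c / of_int d :: rat)" using quotient_of_div[OF cd] .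
  hence "(of_int (a * d) :: rat) = of_int (c * b)"
    using assms d by (simp add: frac_eq_eq)
  hence eq: "a * d = c * b" by (simp only: of_int_eq_iff)
  hence "c \<noteq> 0" using assms d by auto
  have "prime_elem (int p)" using prime_p by simp
  hence "multiplicity (int p) a + multiplicity (int p) d = multiplicity (int p) c + multiplicity (int p) b"
    using arg_cong[OF eq, of "multiplicity (int p)"] assms d \<open>c \<noteq> 0\<close>
    by (simp add: prime_elem_multiplicity_mult_distrib)
  thus ?thesis unfolding rat_val_def cd by simp
qed

lemma rat_split:
  fixes x :: rat
  assumes "x \<noteq> 0"
  obtains a b where "x = of_int a / of_int b" "a \<noteq> 0" "b \<noteq> 0"
proof -
  obtain a b where ab: "quotient_of x = (a, b)" by fastforce
  have "b > 0" "x = of_int a / of_int b" using quotient_of_denom_pos[OF ab] quotient_of_div[OF ab] .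
  thus ?thesis using that[of a b] assms by auto
qed

lemma rat_val_mult:
  assumes "x \<noteq> 0" "y \<noteq> 0"
  shows "rat_val p (x * y) = rat_val p x + rat_val p y"
proof -
  obtain a b where ab: "x = of_int a / of_int b" "a \<noteq> 0" "b \<noteq> 0" by (rule rat_split[OF assms(1)])
  obtain c d where cd: "y = of_int c / of_int d" "c \<noteq> 0" "d \<noteq> 0" by (rule rat_split[OF assms(2)])
  have "x * y = of_int (a * c) / of_int (b * d)" by (simp add: ab cd)
  moreover have "prime_elem (int p)" using prime_p by simp
  ultimately show ?thesis using ab cd rat_val_quotient[of "a * c" "b * d"]
    by (simp add: rat_val_quotient prime_elem_multiplicity_mult_distrib)
qed

lemma rat_val_1: "rat_val p 1 = 0"
  using rat_val_mult[of 1 1] by simp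

lemma rat_val_inverse: "x \<noteq> 0 \<Longrightarrow> rat_val p (inverse x) = - rat_val p x"
  using rat_val_mult[of x "inverse x"] rat_val_1 by simp

lemma rat_val_power: "x \<noteq> 0 \<Longrightarrow> rat_val p (x ^ i) = int i * rat_val p x"
  by (induction i) (simp_all add: rat_val_1 rat_val_mult algebra_simps)

lemma rat_val_p: "rat_val p (of_nat p) = 1"
proof -
  have "multiplicity (int p) (int p) = 1" using prime_p by (intro multiplicity_self) auto
  thus ?thesis using prime_p by (simp add: rat_val_def)
qed

lemma rat_val_power_int: "rat_val p (of_nat p powi e) = e"
  using prime_gt_0_nat[OF prime_p]
  by (cases "e \<ge> 0") (simp_all add: power_int_def rat_val_inverse rat_val_power rat_val_p)

lemma plocal_iff_rat_val:
  assumes "x \<noteq> 0"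
  shows "x \<in> plocal p \<longleftrightarrow> 0 \<le> rat_val p x"
proof
  assume "x \<in> plocal p"
  then obtain a b where ab: "\<not> int p dvd b" "x = of_int a / of_int b" "b \<noteq> 0" by (rule plocalE)
  have "a \<noteq> 0" using ab(2) assms by auto
  thus "0 \<le> rat_val p x" using ab by (simp add: rat_val_quotient not_dvd_imp_multiplicity_0)
next
  assume v: "0 \<le> rat_val p x"
  obtain a b where ab: "quotient_of x = (a, b)" by fastforce
  have b: "b > 0" "x = of_int a / of_int b" "coprime a b"
    using quotient_of_denom_pos[OF ab] quotient_of_div[OF ab] quotient_of_coprime[OF ab] .
  have unit: "\<not> is_unit (int p)" using not_dvd_1 by blast
  have "\<not> int p dvd b"
  proof
    assume dvd: "int p dvd b"
    hence "\<not> int p dvd a" using b(3) unit by (meson coprime_common_divisor)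
    moreover have "multiplicity (int p) b > 0"
      using dvd unit b(1) by (simp add: multiplicity_gt_zero_iff)
    ultimately show False using v ab by (simp add: rat_val_def not_dvd_imp_multiplicity_0)
  qed
  thus "x \<in> plocal p" unfolding b(2) by (rule plocalI)
qed

text \<open>After scaling by p^(-e), valuation e means integral but not divisible by p, and adding a
  multiple of p preserves this.\<close>

lemma rat_val_eq_iff_add:
  assumes "x \<noteq> 0" "x + y \<noteq> 0" "of_nat p powi (- e) * x \<in> plocal p"
    "of_nat p powi (- e) * y / of_nat p \<in> plocal p"
  shows "rat_val p (x + y) = e \<longleftrightarrow> rat_val p x = e"
proof -
  have p0: "(of_nat p :: rat) \<noteq> 0" using prime_gt_0_nat[OF prime_p] by simp
  define q where "q = (of_nat p :: rat) powi (- e)"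
  have q0: "q \<noteq> 0" using p0 by (simp add: q_def)
  have val: "rat_val p z = e \<longleftrightarrow> q * z / of_nat p \<notin> plocal p" if "z \<noteq> 0" "q * z \<in> plocal p" for z
  proof -
    have "rat_val p (q * z) = rat_val p z - e"
      using q0 that(1) by (simp add: rat_val_mult) (simp add: q_def rat_val_power_int)
    moreover have "rat_val p (q * z / of_nat p) = rat_val p (q * z) - 1"
      unfolding divide_inverse using q0 that(1) p0
      by (subst rat_val_mult) (simp_all add: rat_val_inverse rat_val_p)
    ultimately show ?thesis
      using that q0 p0 plocal_iff_rat_val[of "q * z"] plocal_iff_rat_val[of "q * z / of_nat p"] by auto
  qed
  have "q * y = of_nat p * (q * y / of_nat p)" using p0 by simp
  hence qy: "q * y \<in> plocal p" using assms(4) unfolding q_def[symmetric] by (metis plocal_mult plocal_of_nat)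
  have add: "q * (x + y) = q * x + q * y" "q * (x + y) / of_nat p = q * x / of_nat p + q * y / of_nat p"
    by (simp_all add: algebra_simps add_divide_distrib)
  have "q * (x + y) / of_nat p \<in> plocal p \<longleftrightarrow> q * x / of_nat p \<in> plocal p"
    unfolding add(2) using assms(4)[folded q_def] plocal_add[of "q * x / of_nat p" "q * y / of_nat p"]
      plocal_diff[of "q * x / of_nat p + q * y / of_nat p" "q * y / of_nat p"] by auto
  thus ?thesis
    using val[OF assms(1) assms(3)[folded q_def]] val[OF assms(2)] qy assms(3)[folded q_def]
    unfolding add(1) by auto
qed

end

lemma Stirling_pos: "0 < k \<Longrightarrow> k \<le> n \<Longrightarrow> 0 < Stirling n k"
proof (induction n arbitrary: k)
  case (Suc n)
  then obtain l where "k = Suc l" by (cases k) auto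
  thus ?case using Suc by (cases "k = Suc n") auto
qed simp

section \<open>From the polynomial to Stirling numbers\<close>

context fixed_prime begin

text \<open>Descent needs all j >= p - 1: \<open>top_term\<close> handles j = p - 1, and for j >= p
  the gain lemmas apply, iterated when p divides k and once otherwise.\<close>

lemma top_coefficient:
  assumes "0 < k" "k \<le> n" "(p - 1) dvd (n - k)" "of_nat n / of_nat k \<in> plocal p"
    and coeffs: "\<And>j. j \<le> n \<Longrightarrow> g * fps_nth (expm1 ^ k) (n - j) / fact j \<in> plocal p"
  shows "g * fps_nth (expm1 ^ (k + 1)) n / of_nat p \<in> plocal p"
proof (rule rescale_descent[OF assms(3)])
  have W: "pairs_integrally p n (fps_const g * expm1 ^ k)"
    by (rule pairs_integrally_coeffs) (use coeffs in simp)
  fix j assume j: "j \<ge> p - 1"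
  show "g * fps_nth (expm1 ^ (k + j)) n / of_nat p \<in> plocal p"
  proof (cases "j = p - 1")
    case True
    thus ?thesis using top_term[OF assms(1) W assms(4)] by simp
  next
    case False
    with j have j: "j \<ge> p" by simp
    show ?thesis
    proof (cases "p dvd k")
      case True
      have "g * fps_nth (expm1 ^ (k + j)) n / of_nat p ^ (j div p) * of_nat p ^ (j div p - 1) \<in> plocal p"
        by (intro plocal_mult expm1_gain_nth[OF True W] plocal_power plocal_of_nat)
      moreover have "j div p = Suc (j div p - 1)"
        using j prime_gt_0_nat[OF prime_p] by (simp add: div_greater_zero_iff)
      hence "(of_nat p :: rat) ^ (j div p) = of_nat p * of_nat p ^ (j div p - 1)"
        by (metis power_Suc)
      ultimately show ?thesis using prime_gt_0_nat[OF prime_p] by simp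
    next
      case False
      have "pairs_integrally p n (fps_const (g / of_nat p) * expm1 ^ (k - 1 + p) * expm1 ^ (j - (p - 1)))"
        by (intro pairs_integrally_mult pairs_integrally_gain assms False W hurwitz_power hurwitz_expm1)
      hence "fps_nth (fps_const (g / of_nat p) * (expm1 ^ (k - 1 + p) * expm1 ^ (j - (p - 1)))) n \<in> plocal p"
        by (simp only: pairs_integrally_nth flip: mult.assoc)
      moreover have "k - 1 + p + (j - (p - 1)) = k + j"
        using assms(1) j prime_gt_0_nat[OF prime_p] by simp
      ultimately have "fps_nth (fps_const (g / of_nat p) * expm1 ^ (k + j)) n \<in> plocal p"
        by (metis power_add)
      thus ?thesis by simp
    qed
  qed
qed

lemma nu_nonzero: "x \<noteq> 0 \<Longrightarrow> nu p x = ereal (real_of_int (rat_val p x))"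
  by (simp add: nu_def)

lemma nu_mult_eq_iff:
  assumes "c \<noteq> 0" "x \<noteq> 0"
  shows "nu p (c * x) = nu p c - ereal (real_of_int (- e)) \<longleftrightarrow> rat_val p x = e"
  using assms by (simp add: nu_nonzero rat_val_mult)

text \<open>The shift to n + 1, k + 1 keeps both B and the binomial. With e the least coefficient
  valuation of B, the two notions say that B(0), respectively B(1), has valuation e. The alternative
  \<open>n = k\<close> admits n = k = 0, met by the second half of the theorem.\<close>

lemma AMZC_iff_SAMZC:
  assumes "0 < k \<or> n = k" "k \<le> n" "nu p (of_nat k) \<le> nu p (of_nat n)" "(p - 1) dvd (n - k)"
  shows "AMZC p n k \<longleftrightarrow> SAMZC p (n + 1) (k + 1)"
proof -
  define B where "B = ho_bernpoly (n - k) (- int k)"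
  define e where "e = Min (rat_val p ` (set (coeffs B) - {0}))"
  define q where "q = (of_nat p :: rat) powi (- e)"
  \<comment> \<open>Since e^t = 1 + E, these are x = B(0) and x + y = B(1).\<close>
  define x where "x = fact (n - k) * fps_nth (expm1 ^ k) n"
  define y where "y = fact (n - k) * fps_nth (expm1 ^ (k + 1)) n"
  define c :: rat where "c = of_nat (n choose k)"
  have p0: "(of_nat p :: rat) \<noteq> 0" using prime_gt_0_nat[OF prime_p] by simp
  hence q0: "q \<noteq> 0" by (simp add: q_def)
  have c: "c = fact n / (fact k * fact (n - k))" "c \<noteq> 0"
    using assms(2) by (simp_all add: c_def binomial_fact)
  have S: "of_nat (Stirling n k) = c * x"
    using fact_mult_expm1_power_nth[of n k] by (simp add: c x_def field_simps)
  have S': "of_nat (Stirling (n + 1) (k + 1)) = c * (x + y)"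
  proof -
    \<comment> \<open>The recurrence factor k + 1 reduces (k + 1)! to k!, so both summands share the
      constant \<open>c\<close>.\<close>
    have "of_nat (Suc k) * of_nat (Stirling n (Suc k)) = c * y"
      using fact_mult_expm1_power_nth[of n "Suc k"] by (simp add: c y_def field_simps del: power_Suc)
    thus ?thesis using S by (simp add: algebra_simps)
  qed
  have "Stirling n k \<noteq> 0" using assms(1,2) Stirling_pos[of k n] by auto
  hence x0: "x \<noteq> 0" using S by auto
  have "Stirling (n + 1) (k + 1) \<noteq> 0" using assms(2) Stirling_pos[of "k + 1" "n + 1"] by auto
  hence xy0: "x + y \<noteq> 0" using S' by (metis mult_zero_right of_nat_eq_0_iff)
  have local_coeff: "q * coeff B j \<in> plocal p" for j
  proof (cases "coeff B j = 0")
    case False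
    have "coeff B j \<in> set (coeffs B) - {0}" using False coeff_in_coeffs[of B j]
      by (metis Diff_iff coeff_0 le_degree singletonD)
    hence "e \<le> rat_val p (coeff B j)" unfolding e_def by (intro Min_le) auto
    moreover have "rat_val p (q * coeff B j) = rat_val p (coeff B j) - e"
      using False q0 by (simp add: rat_val_mult) (simp add: q_def rat_val_power_int)
    ultimately show ?thesis using False q0 by (subst plocal_iff_rat_val) auto
  qed simp
  have x: "q * x \<in> plocal p"
    using local_coeff[of 0] coeff_ho_bernpoly_uminus[OF assms(2), of 0] by (simp add: B_def x_def)
  have y: "q * y / of_nat p \<in> plocal p"
  proof (cases "n = k")
    case True
    thus ?thesis by (simp add: y_def expm1_power_nth_less del: power_Suc)
  next
    case False
    hence k: "0 < k" "0 < n" using assms(1,2) by auto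
    have "0 \<le> rat_val p (of_nat n / of_nat k)"
      using assms(3) k by (simp add: nu_nonzero divide_inverse rat_val_mult rat_val_inverse)
    hence quot: "of_nat n / of_nat k \<in> plocal p" using k by (subst plocal_iff_rat_val) auto
    have "(q * fact (n - k)) * fps_nth (expm1 ^ (k + 1)) n / of_nat p \<in> plocal p"
    proof (rule top_coefficient[OF k(1) assms(2,4) quot])
      fix j assume "j \<le> n"
      show "(q * fact (n - k)) * fps_nth (expm1 ^ k) (n - j) / fact j \<in> plocal p"
      proof (cases "j \<le> n - k")
        case True
        thus ?thesis using local_coeff[of j] coeff_ho_bernpoly_uminus[OF assms(2), of j]
          by (simp add: B_def mult.assoc)
      next
        case False
        \<comment> \<open>Beyond the degree of B nothing is to be checked, as E^k starts at
          t^k.\<close>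
        hence "n - j < k" using \<open>j \<le> n\<close> assms(2) k(1) by linarith
        thus ?thesis by (simp add: expm1_power_nth_less)
      qed
    qed
    thus ?thesis by (simp add: y_def mult_ac)
  qed
  have "AMZC p n k \<longleftrightarrow> nu p (c * x) = nu p c - ereal (real_of_int (- e))"
    using assms(2) unfolding AMZC_def S c_def[symmetric] B_def[symmetric] max_pole_def e_def by simp
  also have "\<dots> \<longleftrightarrow> rat_val p x = e" by (rule nu_mult_eq_iff[OF c(2) x0])
  also have "\<dots> \<longleftrightarrow> rat_val p (x + y) = e"
    using rat_val_eq_iff_add[OF x0 xy0] x y unfolding q_def by simp
  also have "\<dots> \<longleftrightarrow> nu p (c * (x + y)) = nu p c - ereal (real_of_int (- e))"
    by (rule nu_mult_eq_iff[OF c(2) xy0, symmetric])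
  also have "\<dots> \<longleftrightarrow> SAMZC p (n + 1) (k + 1)"
  proof -
    have "- int (k + 1) + 1 = - int k" "n + 1 - (k + 1) = n - k"
      "n + 1 - 1 = n" "k + 1 - 1 = k" by simp_all
    thus ?thesis using assms(2)
      unfolding SAMZC_def S' max_pole_def e_def B_def c_def by (simp del: Stirling.simps)
  qed
  finally show ?thesis .
qed

lemma AMZC_imp_nu_eq:
  assumes "AMZC p n k" "SAMZC p (n + 1) (k + 1)"
  shows "nu p (of_nat (Stirling (n + 1) (k + 1))) = nu p (of_nat (Stirling n k))"
proof -
  have "- int (k + 1) + 1 = - int k" "n + 1 - (k + 1) = n - k" "n + 1 - 1 = n" "k + 1 - 1 = k"
    by simp_all
  thus ?thesis using assms unfolding AMZC_def SAMZC_def by metis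
qed

end

theorem theorem3p23:
  fixes p n k :: nat
  assumes "prime p" and "1 \<le> k" and "k \<le> n"
  shows "(nu p (of_nat k) \<le> nu p (of_nat n) \<and> (p - 1) dvd (n - k) \<longrightarrow>
            (AMZC p n k \<longleftrightarrow> SAMZC p (n + 1) (k + 1)) \<and>
            (AMZC p n k \<longrightarrow>
               nu p (of_nat (Stirling (n + 1) (k + 1))) = nu p (of_nat (Stirling n k)))) \<and>
         (nu p (of_nat (k - 1)) \<le> nu p (of_nat (n - 1)) \<and> (p - 1) dvd (n - k) \<longrightarrow>
            (AMZC p (n - 1) (k - 1) \<longleftrightarrow> SAMZC p n k) \<and>
            (AMZC p (n - 1) (k - 1) \<longrightarrow>
               nu p (of_nat (Stirling n k)) = nu p (of_nat (Stirling (n - 1) (k - 1)))))"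
proof -
  interpret fixed_prime p by unfold_locales (rule assms(1))
  have first: "(AMZC p n k \<longleftrightarrow> SAMZC p (n + 1) (k + 1)) \<and>
      (AMZC p n k \<longrightarrow> nu p (of_nat (Stirling (n + 1) (k + 1))) = nu p (of_nat (Stirling n k)))"
    if "0 < k \<or> n = k" "k \<le> n" "nu p (of_nat k) \<le> nu p (of_nat n)" "(p - 1) dvd (n - k)" for n k
    using AMZC_iff_SAMZC[OF that] AMZC_imp_nu_eq[of n k] by blast
  have second: "(AMZC p (n - 1) (k - 1) \<longleftrightarrow> SAMZC p n k) \<and>
      (AMZC p (n - 1) (k - 1) \<longrightarrow> nu p (of_nat (Stirling n k)) = nu p (of_nat (Stirling (n - 1) (k - 1))))"
    if "nu p (of_nat (k - 1)) \<le> nu p (of_nat (n - 1))" "(p - 1) dvd (n - k)"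
  proof -
    \<comment> \<open>For \<open>k = 1\<close> the hypothesis reads \<open>\<infinity> \<le> \<nu>\<^sub>p(n - 1)\<close>, which forces \<open>n = 1\<close>.\<close>
    have "0 < k - 1 \<or> n - 1 = k - 1"
      using that(1) assms(2) by (auto simp: nu_def split: if_splits)
    moreover have "n - 1 - (k - 1) = n - k" "n - 1 + 1 = n" "k - 1 + 1 = k" "k - 1 \<le> n - 1"
      using assms(2,3) by simp_all
    ultimately show ?thesis using first[of "k - 1" "n - 1"] that by metis
  qed
  show ?thesis using first[of k n] second assms(2,3) by simp
qed

end
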